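(* Let $\nu\ge 3$ and $X=Sp(2\nu,2)$. For all $x\in O(0,\nu,0)$ and every $O(i,j,k)$ with $i+j+k=\nu$ and $(i,j,k)\neq(0,0,\nu)$, $$|N(x)\cap O(i,j,k)|=\begin{cases}\frac12|O(i,j,k)| & \text{if } j\ge 1,\\ |O(i,j,k)| & \text{if } j=0 \text{ and } i \text{ is odd},\\ 0 & \text{if } j=0 \text{ and } i\text{ is even}.\end{cases}$$ In particular, $O(0,\nu,0)$ is a Godsil–McKay cell in the orbit partition of $\mathrm{Aut}(X)_{\mathcal E}$ on $V(X)$.
   Context: $N(x)$ is the set of neighbors of $x$. Let $R=\begin{bmatrix}0&1\\1&0\end{bmatrix}$ and $K=I_\nu\otimes R$ over $\mathbb{F}_2$. The symplectic graph $Sp(2\nu,2)$ has vertex set $\mathbb{F}_2^{2\nu}\setminus\{\mathbf 0\}$, with $x,y$ adjacent iff $x^TKy=1$. $\mathcal E=\{e_1,\dots,e_{2\nu}\}$ is the standard basis of $\mathbb{F}_2^{2\nu}$ and $\mathrm{Aut}(X)_{\mathcal E}=\{g\in\mathrm{Aut}(X):\mathcal E^g=\mathcal E\}$. Write $x\in\mathbb{F}_2^{2\nu}$ as $\nu$ consecutive blocks $x_1,\dots,x_\nu\in\mathbb{F}_2^2$; $\mathrm{wt}$ denotes the number of non-zero components. For $i+j+k=\nu$, $O(i,j,k)$ is the set of $x\in\mathbb{F}_2^{2\nu}$ with exactly $i$ blocks of weight 2, $j$ blocks of weight 1 and $k$ blocks of weight 0. The orbits of $\mathrm{Aut}(X)_{\mathcal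 E}$ on $V(X)$ are exactly the sets $O(i,j,k)$ with $i+j+k=\nu$, $(i,j,k)\ne(0,0,\nu)$. A cell $D$ of a partition $\{C_1,\dots,C_t,D\}$ of $V(X)$ is a Godsil–McKay cell if (i) for all $i,j\in\{1,\dots,t\}$ any two vertices of $C_i$ have the same number of neighbors in $C_j$, and (ii) for every $x\in D$ and every $i\in\{1,\dots,t\}$, $|N(x)\cap C_i|\in\{0,\frac12|C_i|,|C_i|\}$. *)

theory Defs
  imports
    "HOL-Library.Z2"
    "HOL-Library.Disjoint_Sets"
    "HOL-Algebra.Bij"
    "HOL-Algebra.Group_Action"
    "Jordan_Normal_Form.Matrix"
    "Graph_Theory.Pair_Digraph"
begin

text \<open>
  Graphs are values of the record type \<^typ>\<open>'a pair_pre_digraph\<close>; an undirected edge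
  is represented by both of its orientations. The two-element field is the type \<^typ>\<open>bit\<close>.
  Coordinates, blocks and basis vectors are numbered from 0.
\<close>

definition neighbors :: "'a pair_pre_digraph \<Rightarrow> 'a \<Rightarrow> 'a set" where
  "neighbors X x = {y. (x, y) \<in> parcs X}"

definition Aut :: "'a pair_pre_digraph \<Rightarrow> ('a \<Rightarrow> 'a) monoid" where
  "Aut X = BijGroup (pverts X)
     \<lparr>carrier := {g \<in> Bij (pverts X).
        \<forall>x \<in> pverts X. \<forall>y \<in> pverts X. (g x, g y) \<in> parcs X \<longleftrightarrow> (x, y) \<in> parcs X}\<rparr>"

definition Aut_setwise :: "'a pair_pre_digraph \<Rightarrow> 'a set \<Rightarrow> ('a \<Rightarrow> 'a) monoid" where
  "Aut_setwise X S = Aut X \<lparr>carrier := stabilizer (Aut X) (\<lambda>g T. g ` T) S\<rparr>"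

definition orbit_partition :: "'a pair_pre_digraph \<Rightarrow> ('a \<Rightarrow> 'a) monoid \<Rightarrow> 'a set set" where
  "orbit_partition X G = orbits G (pverts X) (\<lambda>g. g)"

text \<open>The cells \<open>C\<^sub>1, \<dots>, C\<^sub>t\<close> are the members of \<open>P - {D}\<close>.\<close>

definition godsil_mckay_cell :: "'a pair_pre_digraph \<Rightarrow> 'a set set \<Rightarrow> 'a set \<Rightarrow> bool" where
  "godsil_mckay_cell X P D \<longleftrightarrow>
     finite P \<and> partition_on (pverts X) P \<and> D \<in> P \<and>
     (\<forall>C \<in> P - {D}. \<forall>C' \<in> P - {D}. \<forall>x \<in> C. \<forall>y \<in> C.
        card (neighbors X x \<inter> C') = card (neighbors X y \<inter> C')) \<and>
     (\<forall>x \<in> D. \<forall>C \<in> P - {D}.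
        real (card (neighbors X x \<inter> C)) \<in> {0, 1/2 * real (card C), real (card C)})"

definition kronecker :: "'a :: semiring_1 mat \<Rightarrow> 'a mat \<Rightarrow> 'a mat" where
  "kronecker A B = mat (dim_row A * dim_row B) (dim_col A * dim_col B)
     (\<lambda>(i, j). A $$ (i div dim_row B, j div dim_col B) * B $$ (i mod dim_row B, j mod dim_col B))"

definition R_mat :: "bit mat" where
  "R_mat = mat_of_rows_list 2 [[0, 1], [1, 0]]"

definition K_mat :: "nat \<Rightarrow> bit mat" where
  "K_mat \<nu> = kronecker (1\<^sub>m \<nu>) R_mat"

definition symplectic_graph :: "nat \<Rightarrow> bit vec pair_pre_digraph" where
  "symplectic_graph \<nu> =
     (let V = carrier_vec (2 * \<nu>) - {0\<^sub>v (2 * \<nu>)} in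
      \<lparr>pverts = V, parcs = {(x, y). x \<in> V \<and> y \<in> V \<and> x \<bullet> (K_mat \<nu> *\<^sub>v y) = 1}\<rparr>)"

definition std_basis :: "nat \<Rightarrow> bit vec set" where
  "std_basis \<nu> = {unit_vec (2 * \<nu>) l | l. l < 2 * \<nu>}"

definition block :: "bit vec \<Rightarrow> nat \<Rightarrow> bit vec" where
  "block x m = vec 2 (\<lambda>l. x $ (2 * m + l))"

definition wt :: "bit vec \<Rightarrow> nat" where
  "wt v = card {l. l < dim_vec v \<and> v $ l \<noteq> 0}"

text \<open>The set \<open>O(i, j, k)\<close>. It is empty unless \<open>i + j + k = \<nu>\<close>.\<close>

definition O_set :: "nat \<Rightarrow> nat \<Rightarrow> nat \<Rightarrow> nat \<Rightarrow> bit vec set" where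
  "O_set \<nu> i j k = {x \<in> carrier_vec (2 * \<nu>).
     card {m. m < \<nu> \<and> wt (block x m) = 2} = i \<and>
     card {m. m < \<nu> \<and> wt (block x m) = 1} = j \<and>
     card {m. m < \<nu> \<and> wt (block x m) = 0} = k}"

end

theory Submission
  imports Defs
begin

text \<open>
  In the coordinates of the blocks, the symplectic form is
  \<open>(\<Sum>m<\<nu>. x\<^sub>2\<^sub>m y\<^sub>2\<^sub>m\<^sub>+\<^sub>1 + x\<^sub>2\<^sub>m\<^sub>+\<^sub>1 y\<^sub>2\<^sub>m)\<close>. Let every block of \<open>x\<close> have weight 1. A block
  of weight 2 of \<open>y\<close> then contributes 1 to the form, a block of weight 0 contributes 0, and the
  contribution of a block of weight 1 changes when its two coordinates are swapped. So if a set of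
  vectors \<open>y\<close> is closed under swaps inside single blocks and each of its members has a
  block of weight 1, then swapping the first such block is an involution of the set that exchanges
  neighbours and non-neighbours of \<open>x\<close>: exactly half of the set is adjacent to \<open>x\<close>. Without
  blocks of weight 1 the adjacency is decided by the parity of the number of blocks of weight 2.
  This count (lemma \<open>card_neighbors_swap_closed_set\<close>) is stated for all swap-closed sets on which
  the numbers of blocks of weight 1 and 2 are constant. It applies to the sets \<open>O(i, j, k)\<close>
  and equally to the orbits of the stabilizer of the standard basis.

  Orbits qualify for two reasons. Swaps inside blocks are automorphisms that permute the
  basis, hence orbits are swap-closed. Conversely, the edges between basis vectors are the pairs
  \<open>{e\<^sub>2\<^sub>m, e\<^sub>2\<^sub>m\<^sub>+\<^sub>1}\<close>, and the weight of block \<open>m\<close> of \<open>y\<close> is the number of neighbours of \<open>y\<close> in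
  that pair. Weights of blocks are thereby expressed through adjacency and the basis alone, so
  every automorphism fixing the basis setwise, linear or not, preserves the number of blocks of
  each weight (lemma \<open>card_blocks_of_weight_orbit\<close>).

  It remains that \<open>O(0, \<nu>, 0)\<close> is a single orbit, which holds because two vectors with
  all blocks of weight 1 differ by swaps inside blocks, and that the orbits other than
  \<open>O(0, \<nu>, 0)\<close> form an equitable family, which holds for the orbits of any group of
  automorphisms.
\<close>

section \<open>Automorphisms stabilizing a set, and their orbits\<close>

lemma carrier_Aut_setwise:
  "g \<in> carrier (Aut_setwise X S) \<longleftrightarrow>
     g \<in> Bij (pverts X) \<and>
     (\<forall>x \<in> pverts X. \<forall>y \<in> pverts X. (g x, g y) \<in> parcs X \<longleftrightarrow> (x, y) \<in> parcs X) \<and>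
     g ` S = S"
  by (auto simp: Aut_setwise_def Aut_def stabilizer_def)

lemma Aut_setwise_subgroup:
  assumes "S \<subseteq> pverts X"
  shows "subgroup (carrier (Aut_setwise X S)) (BijGroup (pverts X))"
proof (rule subgroup.intro)
  let ?V = "pverts X" and ?A = "carrier (Aut_setwise X S)"
  show "?A \<subseteq> carrier (BijGroup ?V)"
    by (auto simp: carrier_Aut_setwise BijGroup_def)
  show "\<one>\<^bsub>BijGroup ?V\<^esub> \<in> ?A"
    using assms by (auto simp: carrier_Aut_setwise BijGroup_def id_Bij)
  show "g \<otimes>\<^bsub>BijGroup ?V\<^esub> h \<in> ?A" if "g \<in> ?A" "h \<in> ?A" for g h
  proof -
    have g: "g \<in> Bij ?V" "g ` S = S" and h: "h \<in> Bij ?V" "h ` S = S"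
      using that by (auto simp: carrier_Aut_setwise)
    have hV: "h x \<in> ?V" if "x \<in> ?V" for x
      using h(1) that by (auto dest: Bij_imp_funcset)
    have "compose ?V g h ` S = g ` h ` S"
      using assms by (force simp: compose_def)
    then have "compose ?V g h ` S = S"
      by (simp add: g h)
    moreover have "(compose ?V g h x, compose ?V g h y) \<in> parcs X \<longleftrightarrow> (x, y) \<in> parcs X"
      if "x \<in> ?V" "y \<in> ?V" for x y
      using that hV \<open>g \<in> ?A\<close> \<open>h \<in> ?A\<close> by (simp add: compose_eq carrier_Aut_setwise)
    ultimately show ?thesis
      using g(1) h(1) by (simp add: BijGroup_def carrier_Aut_setwise compose_Bij)
  qed
  show "inv\<^bsub>BijGroup ?V\<^esub> g \<in> ?A" if "g \<in> ?A" for g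
  proof -
    let ?h = "\<lambda>x\<in>?V. inv_into ?V g x"
    have g: "g \<in> Bij ?V" "g ` S = S" "inj_on g ?V" "g ` ?V = ?V"
      using that by (auto simp: carrier_Aut_setwise Bij_def bij_betw_def)
    have hg: "?h (g x) = x" if "x \<in> ?V" for x
      using that g by (metis imageI inv_into_f_f restrict_apply')
    have gh: "\<exists>x' \<in> ?V. x = g x'" if "x \<in> ?V" for x
      using that g by blast
    have "?h ` g ` S = (\<lambda>x. ?h (g x)) ` S"
      by (rule image_image)
    also have "\<dots> = (\<lambda>x. x) ` S"
      using assms hg by (intro image_cong refl) blast
    finally have "?h ` S = S"
      by (simp add: g(2))
    moreover have "(?h x, ?h y) \<in> parcs X \<longleftrightarrow> (x, y) \<in> parcs X"
      if xy: "x \<in> ?V" "y \<in> ?V" for x y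
    proof -
      obtain x' y' where "x' \<in> ?V" "x = g x'" "y' \<in> ?V" "y = g y'"
        using xy gh by blast
      then show ?thesis
        using \<open>g \<in> ?A\<close> by (simp add: hg carrier_Aut_setwise del: restrict_apply)
    qed
    ultimately show ?thesis
      using g(1) restrict_inv_into_Bij[OF g(1)]
      by (simp add: inv_BijGroup carrier_Aut_setwise del: restrict_apply)
  qed
qed

lemma Aut_setwise_action:
  assumes "S \<subseteq> pverts X"
  shows "group_action (Aut_setwise X S) (pverts X) (\<lambda>g. g)"
proof -
  interpret B: group "BijGroup (pverts X)"
    by (rule group_BijGroup)
  have eq: "Aut_setwise X S = (BijGroup (pverts X))\<lparr>carrier := carrier (Aut_setwise X S)\<rparr>"
    by (simp add: Aut_setwise_def Aut_def)
  have "group (Aut_setwise X S)"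
    by (subst eq) (rule B.subgroup_imp_group[OF Aut_setwise_subgroup[OF assms]])
  moreover have "(\<lambda>g. g) \<in> hom (Aut_setwise X S) (BijGroup (pverts X))"
    using subgroup.subset[OF Aut_setwise_subgroup[OF assms]]
    by (subst eq) (auto simp: hom_def)
  ultimately show ?thesis
    by (intro group_action.intro group_hom.intro group_hom_axioms.intro group_BijGroup)
qed

lemma partition_orbit_partition:
  assumes "S \<subseteq> pverts X"
  shows "partition_on (pverts X) (orbit_partition X (Aut_setwise X S))"
proof -
  interpret group_action "Aut_setwise X S" "pverts X" "\<lambda>g. g"
    by (rule Aut_setwise_action[OF assms])
  show ?thesis
    unfolding orbit_partition_def
  proof (rule partition_onI)
    show "\<Union> (orbits (Aut_setwise X S) (pverts X) (\<lambda>g. g)) = pverts X"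
      by (rule orbits_coverture)
    show "{} \<notin> orbits (Aut_setwise X S) (pverts X) (\<lambda>g. g)"
      using orbit_refl by (fastforce simp: orbits_def)
  qed (use disjoint_union in \<open>auto simp: disjnt_def\<close>)
qed

lemma image_neighbors:
  assumes "g \<in> carrier (Aut_setwise X S)" "y \<in> pverts X" "M \<subseteq> pverts X"
  shows "g ` (neighbors X y \<inter> M) = neighbors X (g y) \<inter> g ` M"
  using assms by (auto simp: carrier_Aut_setwise neighbors_def)

text \<open>Orbit partitions are equitable: an automorphism moving \<open>x\<close> to \<open>y\<close> injects the
  neighbours of \<open>x\<close> in a cell into those of \<open>y\<close>, and the relation between \<open>x\<close> and \<open>y\<close>
  is symmetric.\<close>

lemma orbit_partition_equitable:
  assumes S: "S \<subseteq> pverts X" and fin: "finite (pverts X)"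
    and C: "C \<in> orbit_partition X (Aut_setwise X S)"
    and C': "C' \<in> orbit_partition X (Aut_setwise X S)"
    and xy: "x \<in> C" "y \<in> C"
  shows "card (neighbors X x \<inter> C') = card (neighbors X y \<inter> C')"
proof -
  interpret group_action "Aut_setwise X S" "pverts X" "\<lambda>g. g"
    by (rule Aut_setwise_action[OF S])
  let ?orb = "orbit (Aut_setwise X S) (\<lambda>g. g)"
  obtain z where z: "z \<in> pverts X" "C = ?orb z"
    using C by (auto simp: orbit_partition_def orbits_def)
  obtain z' where z': "z' \<in> pverts X" "C' = ?orb z'"
    using C' by (auto simp: orbit_partition_def orbits_def)
  have in_V: "u \<in> pverts X" if "u \<in> ?orb v" "v \<in> pverts X" for u v
    using that element_image by (auto simp: orbit_def)
  have le: "card (neighbors X u \<inter> C') \<le> card (neighbors X v \<inter> C')"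
    if "u \<in> C" "v \<in> C" for u v
  proof -
    have V: "u \<in> pverts X" "v \<in> pverts X" "C' \<subseteq> pverts X"
      using that z z' in_V by auto
    have "v \<in> ?orb u"
      using that z V orbit_sym orbit_trans by blast
    then obtain g where g: "g \<in> carrier (Aut_setwise X S)" "v = g u"
      by (auto simp: orbit_def)
    have "g ` C' \<subseteq> C'"
    proof
      fix w assume "w \<in> g ` C'"
      then obtain c where c: "c \<in> C'" "w = g c" by blast
      then have "w \<in> ?orb c" "w \<in> pverts X"
        using g V element_image by (auto simp: orbit_def)
      then show "w \<in> C'"
        using c z' V orbit_trans by blast
    qed
    then have "g ` (neighbors X u \<inter> C') \<subseteq> neighbors X v \<inter> C'"
      using image_neighbors[OF g(1) V(1,3)] g(2) by auto
    moreover have "inj_on g (neighbors X u \<inter> C')"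
      using inj_prop[OF g(1)] V(3) by (blast intro: inj_on_subset)
    ultimately show ?thesis
      using finite_subset[OF V(3) fin] by (metis card_inj_on_le finite_Int)
  qed
  show ?thesis
    using le xy by (simp add: order_antisym)
qed

section \<open>The symplectic form in coordinates\<close>

text \<open>The other coordinate position in the block that contains position \<open>l\<close>.\<close>

definition partner :: "nat \<Rightarrow> nat" where
  "partner l = (if even l then l + 1 else l - 1)"

definition basis_pair :: "nat \<Rightarrow> nat \<Rightarrow> bit vec set" where
  "basis_pair \<nu> m = {unit_vec (2 * \<nu>) (2 * m), unit_vec (2 * \<nu>) (2 * m + 1)}"

definition blocks_of_weight :: "nat \<Rightarrow> nat \<Rightarrow> bit vec \<Rightarrow> nat set" where
  "blocks_of_weight \<nu> w x = {m. m < \<nu> \<and> wt (block x m) = w}"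

lemma partner_less: "l < 2 * \<nu> \<Longrightarrow> partner l < 2 * \<nu>"
  by (auto simp: partner_def elim!: evenE)

lemma partner_partner [simp]: "partner (partner l) = l"
  by (auto simp: partner_def)

lemma partner_div_2 [simp]: "partner l div 2 = l div 2"
  by (auto simp: partner_def elim!: oddE)

lemma partner_double [simp]: "partner (2 * m) = 2 * m + 1" "partner (Suc (2 * m)) = 2 * m"
  by (auto simp: partner_def)

lemma K_mat_dim [simp]: "dim_row (K_mat \<nu>) = 2 * \<nu>" "dim_col (K_mat \<nu>) = 2 * \<nu>"
  by (auto simp: K_mat_def kronecker_def R_mat_def mat_of_rows_list_def)

lemma K_mat_index:
  assumes "i < 2 * \<nu>" "j < 2 * \<nu>"
  shows "K_mat \<nu> $$ (i, j) = (if j = partner i then 1 else 0)"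
proof -
  have R: "R_mat $$ (a mod 2, b mod 2) = (if even a = even b then 0 else 1)" for a b :: nat
    by (simp add: R_mat_def mat_of_rows_list_def mod2_eq_if)
  have "K_mat \<nu> $$ (i, j) = 1\<^sub>m \<nu> $$ (i div 2, j div 2) * R_mat $$ (i mod 2, j mod 2)"
  proof -
    have "dim_row R_mat = 2" "dim_col R_mat = 2"
      by (simp_all add: R_mat_def mat_of_rows_list_def)
    then show ?thesis
      using assms by (simp add: K_mat_def kronecker_def mult.commute del: mult_bit_eq_and)
  qed
  also have "\<dots> = (if i div 2 = j div 2 \<and> even i \<noteq> even j then 1 else 0)"
    using assms by (simp add: R less_mult_imp_div_less mult.commute)
  also have "(i div 2 = j div 2 \<and> even i \<noteq> even j) \<longleftrightarrow> j = partner i"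
    by (auto simp: partner_def elim!: oddE evenE) presburger
  finally show ?thesis .
qed

lemma symplectic_form_partner:
  assumes "x \<in> carrier_vec (2 * \<nu>)" "y \<in> carrier_vec (2 * \<nu>)"
  shows "x \<bullet> (K_mat \<nu> *\<^sub>v y) = (\<Sum>l<2 * \<nu>. x $ l * y $ partner l)"
proof -
  have "(K_mat \<nu> *\<^sub>v y) $ l = y $ partner l" if l: "l < 2 * \<nu>" for l
  proof -
    have "(K_mat \<nu> *\<^sub>v y) $ l = (\<Sum>j\<in>{0..<2 * \<nu>}. K_mat \<nu> $$ (l, j) * y $ j)"
      using l assms by (simp add: scalar_prod_def del: mult_bit_eq_and)
    also have "\<dots> = (\<Sum>j\<in>{0..<2 * \<nu>}. if j = partner l then y $ j else 0)"
      using l by (intro sum.cong) (simp_all add: K_mat_index)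
    also have "\<dots> = y $ partner l"
      using partner_less[OF l] by (subst sum.delta) auto
    finally show ?thesis .
  qed
  then show ?thesis
    by (simp add: scalar_prod_def atLeast0LessThan)
qed

lemma sum_lessThan_double: "(\<Sum>l<2 * n. f l) = (\<Sum>m<n. f (2 * m) + f (Suc (2 * m)))"
  for f :: "nat \<Rightarrow> 'a :: comm_monoid_add"
  by (induction n) (simp_all add: add.assoc)

lemma symplectic_form_blocks:
  assumes "x \<in> carrier_vec (2 * \<nu>)" "y \<in> carrier_vec (2 * \<nu>)"
  shows "x \<bullet> (K_mat \<nu> *\<^sub>v y) =
    (\<Sum>m<\<nu>. x $ (2 * m) * y $ (2 * m + 1) + x $ (2 * m + 1) * y $ (2 * m))"
  by (simp add: symplectic_form_partner[OF assms] sum_lessThan_double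
      del: add_bit_eq_xor mult_bit_eq_and)

lemma pverts_symplectic_graph:
  "pverts (symplectic_graph \<nu>) = carrier_vec (2 * \<nu>) - {0\<^sub>v (2 * \<nu>)}"
  by (simp add: symplectic_graph_def Let_def)

lemma parcs_symplectic_graph:
  "(x, y) \<in> parcs (symplectic_graph \<nu>) \<longleftrightarrow>
     x \<in> pverts (symplectic_graph \<nu>) \<and> y \<in> pverts (symplectic_graph \<nu>) \<and>
     x \<bullet> (K_mat \<nu> *\<^sub>v y) = 1"
  by (simp add: symplectic_graph_def Let_def)

lemma finite_pverts_symplectic_graph: "finite (pverts (symplectic_graph \<nu>))"
proof -
  have "carrier_vec (2 * \<nu>) \<subseteq>
      (\<lambda>S. vec (2 * \<nu>) (\<lambda>l. if l \<in> S then 1 else 0 :: bit)) ` Pow {..<2 * \<nu>}"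
  proof
    fix x :: "bit vec" assume "x \<in> carrier_vec (2 * \<nu>)"
    then have "x = vec (2 * \<nu>) (\<lambda>l. if l \<in> {l. l < 2 * \<nu> \<and> x $ l = 1} then 1 else 0)"
      by auto
    then show "x \<in> (\<lambda>S. vec (2 * \<nu>) (\<lambda>l. if l \<in> S then 1 else 0 :: bit)) ` Pow {..<2 * \<nu>}"
      by blast
  qed
  then show ?thesis
    unfolding pverts_symplectic_graph
    by (meson finite_Diff finite_Pow_iff finite_imageI finite_lessThan finite_subset)
qed

lemma unit_vec_in_pverts: "l < 2 * \<nu> \<Longrightarrow> unit_vec (2 * \<nu>) l \<in> pverts (symplectic_graph \<nu>)"
  by (auto simp: pverts_symplectic_graph)

lemma std_basis_subset_pverts: "std_basis \<nu> \<subseteq> pverts (symplectic_graph \<nu>)"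
  by (auto simp: std_basis_def unit_vec_in_pverts)

text \<open>The neighbours of \<open>y\<close> among the basis vectors determine \<open>y\<close>: each of them reads off one
  coordinate.\<close>

lemma unit_vec_in_neighbors_iff:
  assumes "y \<in> pverts (symplectic_graph \<nu>)" "l < 2 * \<nu>"
  shows "unit_vec (2 * \<nu>) l \<in> neighbors (symplectic_graph \<nu>) y \<longleftrightarrow> y $ partner l = 1"
proof -
  have y: "y \<in> carrier_vec (2 * \<nu>)"
    using assms by (simp add: pverts_symplectic_graph)
  have "y \<bullet> (K_mat \<nu> *\<^sub>v unit_vec (2 * \<nu>) l) =
      (\<Sum>i<2 * \<nu>. y $ i * unit_vec (2 * \<nu>) l $ partner i)"
    by (rule symplectic_form_partner[OF y]) simp
  also have "\<dots> = (\<Sum>i<2 * \<nu>. if i = partner l then y $ i else 0)"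
    using assms by (intro sum.cong) (auto simp: partner_less)
  also have "\<dots> = y $ partner l"
    using partner_less[OF assms(2)] by simp
  finally show ?thesis
    using assms by (simp add: neighbors_def parcs_symplectic_graph unit_vec_in_pverts)
qed

lemma wt_block:
  "wt (block x m) = (if x $ (2 * m) = 1 then 1 else 0) + (if x $ (2 * m + 1) = 1 then 1 else 0)"
proof -
  have idx: "dim_vec (block x m) = 2" "block x m $ 0 = x $ (2 * m)"
    "block x m $ Suc 0 = x $ (2 * m + 1)"
    by (simp_all add: block_def)
  have "{l. l < dim_vec (block x m) \<and> block x m $ l \<noteq> 0} =
      (if x $ (2 * m) = 1 then {0} else {}) \<union> (if x $ (2 * m + 1) = 1 then {1} else {})"
    using idx by (auto simp: less_2_cases_iff intro: gr0I)
  then show ?thesis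
    by (simp add: wt_def)
qed

lemma wt_block_eq_1_iff: "wt (block x m) = 1 \<longleftrightarrow> x $ (2 * m + 1) = x $ (2 * m) + 1"
  by (cases "x $ (2 * m)"; cases "x $ (2 * m + 1)") (simp_all add: wt_block)

lemma O_set_iff:
  "x \<in> O_set \<nu> i j k \<longleftrightarrow> x \<in> carrier_vec (2 * \<nu>) \<and>
     card (blocks_of_weight \<nu> 2 x) = i \<and> card (blocks_of_weight \<nu> 1 x) = j \<and>
     card (blocks_of_weight \<nu> 0 x) = k"
  by (simp add: O_set_def blocks_of_weight_def)

lemma finite_blocks_of_weight [simp]: "finite (blocks_of_weight \<nu> w x)"
  by (simp add: blocks_of_weight_def)

lemma O_set_subset_pverts:
  assumes "(i, j, k) \<noteq> (0, 0, \<nu>)"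
  shows "O_set \<nu> i j k \<subseteq> pverts (symplectic_graph \<nu>)"
proof -
  have "0\<^sub>v (2 * \<nu>) \<notin> O_set \<nu> i j k"
  proof
    assume zero: "0\<^sub>v (2 * \<nu>) \<in> O_set \<nu> i j k"
    have "wt (block (0\<^sub>v (2 * \<nu>)) m) = 0" if "m < \<nu>" for m
      using that by (simp add: wt_block)
    then have "blocks_of_weight \<nu> 2 (0\<^sub>v (2 * \<nu>)) = {}"
      "blocks_of_weight \<nu> 1 (0\<^sub>v (2 * \<nu>)) = {}"
      "blocks_of_weight \<nu> 0 (0\<^sub>v (2 * \<nu>)) = {..<\<nu>}"
      by (auto simp: blocks_of_weight_def)
    then show False
      using zero assms by (simp add: O_set_iff)
  qed
  then show ?thesis
    by (auto simp: pverts_symplectic_graph O_set_iff)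
qed

lemma O_set_all_weight_one_iff:
  "x \<in> O_set \<nu> 0 \<nu> 0 \<longleftrightarrow> x \<in> carrier_vec (2 * \<nu>) \<and> (\<forall>m<\<nu>. wt (block x m) = 1)"
proof
  assume x: "x \<in> O_set \<nu> 0 \<nu> 0"
  have "blocks_of_weight \<nu> 1 x = {..<\<nu>}"
    by (rule card_subset_eq) (use x in \<open>auto simp: O_set_iff blocks_of_weight_def\<close>)
  then show "x \<in> carrier_vec (2 * \<nu>) \<and> (\<forall>m<\<nu>. wt (block x m) = 1)"
    using x by (auto simp: O_set_iff blocks_of_weight_def)
next
  assume x: "x \<in> carrier_vec (2 * \<nu>) \<and> (\<forall>m<\<nu>. wt (block x m) = 1)"
  then have "blocks_of_weight \<nu> 2 x = {}" "blocks_of_weight \<nu> 1 x = {..<\<nu>}"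
    "blocks_of_weight \<nu> 0 x = {}"
    by (auto simp: blocks_of_weight_def)
  then show "x \<in> O_set \<nu> 0 \<nu> 0"
    using x by (simp add: O_set_iff)
qed

section \<open>Swapping the two coordinates of chosen blocks\<close>

definition swap_blocks :: "nat set \<Rightarrow> bit vec \<Rightarrow> bit vec" where
  "swap_blocks S x = vec (dim_vec x) (\<lambda>l. if l div 2 \<in> S then x $ partner l else x $ l)"

lemma swap_blocks_carrier [simp]: "swap_blocks S x \<in> carrier_vec n \<longleftrightarrow> x \<in> carrier_vec n"
  unfolding swap_blocks_def carrier_vec_def by simp

lemma swap_blocks_index:
  assumes "x \<in> carrier_vec (2 * \<nu>)" "l < 2 * \<nu>"
  shows "swap_blocks S x $ l = (if l div 2 \<in> S then x $ partner l else x $ l)"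
  using assms by (simp add: swap_blocks_def)

lemma swap_blocks_swap_blocks:
  assumes "x \<in> carrier_vec (2 * \<nu>)"
  shows "swap_blocks S (swap_blocks S x) = x"
  using assms by (intro eq_vecI) (auto simp: swap_blocks_def partner_less)

lemma wt_block_swap_blocks:
  assumes "x \<in> carrier_vec (2 * \<nu>)" "m < \<nu>"
  shows "wt (block (swap_blocks S x) m) = wt (block x m)"
  using assms by (simp add: wt_block swap_blocks_index)

lemma blocks_of_weight_swap_blocks:
  assumes "x \<in> carrier_vec (2 * \<nu>)"
  shows "blocks_of_weight \<nu> w (swap_blocks S x) = blocks_of_weight \<nu> w x"
  using assms by (auto simp: blocks_of_weight_def wt_block_swap_blocks)

lemma swap_blocks_in_O_set: "y \<in> O_set \<nu> i j k \<Longrightarrow> swap_blocks S y \<in> O_set \<nu> i j k"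
  by (simp add: O_set_iff blocks_of_weight_swap_blocks)

lemma symplectic_form_swap_blocks:
  assumes "x \<in> carrier_vec (2 * \<nu>)" "y \<in> carrier_vec (2 * \<nu>)"
  shows "swap_blocks S x \<bullet> (K_mat \<nu> *\<^sub>v swap_blocks S y) = x \<bullet> (K_mat \<nu> *\<^sub>v y)"
proof -
  have "swap_blocks S x \<bullet> (K_mat \<nu> *\<^sub>v swap_blocks S y) =
      (\<Sum>m<\<nu>. swap_blocks S x $ (2 * m) * swap_blocks S y $ (2 * m + 1) +
        swap_blocks S x $ (2 * m + 1) * swap_blocks S y $ (2 * m))"
    using assms by (simp add: symplectic_form_blocks del: add_bit_eq_xor mult_bit_eq_and)
  also have "\<dots> = (\<Sum>m<\<nu>. x $ (2 * m) * y $ (2 * m + 1) + x $ (2 * m + 1) * y $ (2 * m))"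
    using assms
    by (intro sum.cong)
       (auto simp: swap_blocks_index add.commute simp del: add_bit_eq_xor mult_bit_eq_and)
  finally show ?thesis
    using assms by (simp add: symplectic_form_blocks del: add_bit_eq_xor mult_bit_eq_and)
qed

lemma swap_blocks_zero: "swap_blocks S (0\<^sub>v (2 * \<nu>)) = 0\<^sub>v (2 * \<nu>)"
  by (intro eq_vecI) (auto simp: swap_blocks_def partner_less)

lemma swap_blocks_in_pverts:
  assumes "x \<in> pverts (symplectic_graph \<nu>)"
  shows "swap_blocks S x \<in> pverts (symplectic_graph \<nu>)"
proof -
  have x: "x \<in> carrier_vec (2 * \<nu>)" "x \<noteq> 0\<^sub>v (2 * \<nu>)"
    using assms by (simp_all add: pverts_symplectic_graph)
  then have "swap_blocks S x \<noteq> 0\<^sub>v (2 * \<nu>)"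
    using swap_blocks_swap_blocks[OF x(1)] swap_blocks_zero by metis
  then show ?thesis
    using x(1) by (simp add: pverts_symplectic_graph)
qed

lemma swap_blocks_unit_vec:
  assumes "l < 2 * \<nu>"
  shows "swap_blocks S (unit_vec (2 * \<nu>) l) =
    unit_vec (2 * \<nu>) (if l div 2 \<in> S then partner l else l)"
  using assms
  by (intro eq_vecI) (auto simp: swap_blocks_def unit_vec_def partner_less)

lemma swap_blocks_in_Aut_setwise:
  fixes \<nu> :: nat
  defines "V \<equiv> pverts (symplectic_graph \<nu>)"
  shows "restrict (swap_blocks S) V \<in> carrier (Aut_setwise (symplectic_graph \<nu>) (std_basis \<nu>))"
proof -
  let ?g = "restrict (swap_blocks S) V"
  have V: "swap_blocks S x \<in> V" "swap_blocks S (swap_blocks S x) = x" if "x \<in> V" for x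
    using that swap_blocks_in_pverts[of x \<nu> S] swap_blocks_swap_blocks[of x \<nu> S]
    by (simp_all add: V_def pverts_symplectic_graph)
  have "bij_betw ?g V V"
    by (rule bij_betw_byWitness[where f' = ?g]) (auto simp: V)
  then have "?g \<in> Bij V"
    by (simp add: Bij_def)
  moreover have "(?g x, ?g y) \<in> parcs (symplectic_graph \<nu>) \<longleftrightarrow>
      (x, y) \<in> parcs (symplectic_graph \<nu>)" if "x \<in> V" "y \<in> V" for x y
  proof -
    have "swap_blocks S x \<bullet> (K_mat \<nu> *\<^sub>v swap_blocks S y) = x \<bullet> (K_mat \<nu> *\<^sub>v y)"
      using that by (intro symplectic_form_swap_blocks) (simp_all add: V_def pverts_symplectic_graph)
    then show ?thesis
      using that V by (simp add: parcs_symplectic_graph flip: V_def)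
  qed
  moreover have "?g ` std_basis \<nu> = std_basis \<nu>"
  proof -
    have sub: "swap_blocks S ` std_basis \<nu> \<subseteq> std_basis \<nu>"
      by (auto simp: std_basis_def swap_blocks_unit_vec partner_less)
    have "std_basis \<nu> \<subseteq> V"
      by (simp add: V_def std_basis_subset_pverts)
    then have "std_basis \<nu> = swap_blocks S ` swap_blocks S ` std_basis \<nu>"
      using V(2) by (force simp: image_image)
    then have "swap_blocks S ` std_basis \<nu> = std_basis \<nu>"
      using sub by blast
    moreover have "?g ` std_basis \<nu> = swap_blocks S ` std_basis \<nu>"
      using \<open>std_basis \<nu> \<subseteq> V\<close> by (intro image_cong) auto
    ultimately show ?thesis
      by (simp only:)
  qed
  ultimately show ?thesis
    by (simp add: carrier_Aut_setwise V_def)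
qed

section \<open>Counting the neighbours of a vector whose blocks all have weight 1\<close>

text \<open>If \<open>x\<close> is \<open>(1, 0)\<close> or \<open>(0, 1)\<close> on block \<open>m\<close>, then this block of the form picks out one
  coordinate of \<open>y\<close>, and the two coordinates of a block of weight 1 are different.\<close>

lemma symplectic_form_swap_one_block:
  assumes x: "x \<in> carrier_vec (2 * \<nu>)" and y: "y \<in> carrier_vec (2 * \<nu>)"
    and m: "m < \<nu>" "wt (block x m) = 1" "wt (block y m) = 1"
  shows "x \<bullet> (K_mat \<nu> *\<^sub>v swap_blocks {m} y) = x \<bullet> (K_mat \<nu> *\<^sub>v y) + 1"
proof -
  let ?t = "\<lambda>z n. x $ (2 * n) * z $ (2 * n + 1) + x $ (2 * n + 1) * z $ (2 * n)"
  have split: "x \<bullet> (K_mat \<nu> *\<^sub>v z) = ?t z m + (\<Sum>n\<in>{..<\<nu>} - {m}. ?t z n)"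
    if "z \<in> carrier_vec (2 * \<nu>)" for z
    unfolding symplectic_form_blocks[OF x that] by (rule sum.remove) (use m(1) in auto)
  have rest: "(\<Sum>n\<in>{..<\<nu>} - {m}. ?t (swap_blocks {m} y) n) = (\<Sum>n\<in>{..<\<nu>} - {m}. ?t y n)"
    using y by (intro sum.cong) (auto simp: swap_blocks_index
        simp del: add_bit_eq_xor mult_bit_eq_and)
  have "?t (swap_blocks {m} y) m = ?t y m + 1"
  proof -
    have "swap_blocks {m} y $ (2 * m) = y $ (2 * m + 1)"
      "swap_blocks {m} y $ (2 * m + 1) = y $ (2 * m)"
      using m(1) y by (simp_all add: swap_blocks_index)
    then show ?thesis
      using m(2,3) unfolding wt_block_eq_1_iff
      by (cases "x $ (2 * m)"; cases "y $ (2 * m)") simp_all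
  qed
  then show ?thesis
    using y rest by (simp add: split add.assoc add.commute add.left_commute
        del: add_bit_eq_xor mult_bit_eq_and)
qed

lemma of_nat_bit_eq_1_iff: "(of_nat n :: bit) = 1 \<longleftrightarrow> odd n"
  by (induction n) (auto simp del: add_bit_eq_xor)

lemma symplectic_form_no_weight_one:
  assumes x: "x \<in> carrier_vec (2 * \<nu>)" and y: "y \<in> carrier_vec (2 * \<nu>)"
    and x1: "\<And>m. m < \<nu> \<Longrightarrow> wt (block x m) = 1" and y1: "blocks_of_weight \<nu> 1 y = {}"
  shows "x \<bullet> (K_mat \<nu> *\<^sub>v y) = of_nat (card (blocks_of_weight \<nu> 2 y))"
proof -
  have "x $ (2 * m) * y $ (2 * m + 1) + x $ (2 * m + 1) * y $ (2 * m) =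
      (if m \<in> blocks_of_weight \<nu> 2 y then 1 else 0)" if "m < \<nu>" for m
    using x1[OF that] y1 that
    by (auto simp: blocks_of_weight_def wt_block split: if_splits)
  then have "x \<bullet> (K_mat \<nu> *\<^sub>v y) = (\<Sum>m<\<nu>. if m \<in> blocks_of_weight \<nu> 2 y then 1 else 0)"
    unfolding symplectic_form_blocks[OF x y] by (intro sum.cong) auto
  also have "\<dots> = of_nat (card ({..<\<nu>} \<inter> blocks_of_weight \<nu> 2 y))"
    by (simp add: sum.If_cases Int_def)
  also have "{..<\<nu>} \<inter> blocks_of_weight \<nu> 2 y = blocks_of_weight \<nu> 2 y"
    by (auto simp: blocks_of_weight_def)
  finally show ?thesis .
qed

text \<open>The block to be swapped must depend on \<open>y\<close>. Swapping changes no block weight, so the least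
  block of weight 1 is the same before and after, and the map is an involution.\<close>

lemma half_of_swap_closed_set:
  assumes x: "x \<in> O_set \<nu> 0 \<nu> 0" "x \<in> pverts (symplectic_graph \<nu>)"
    and C: "C \<subseteq> pverts (symplectic_graph \<nu>)"
    and closed: "\<And>y m. y \<in> C \<Longrightarrow> m < \<nu> \<Longrightarrow> swap_blocks {m} y \<in> C"
    and ne: "\<And>y. y \<in> C \<Longrightarrow> blocks_of_weight \<nu> 1 y \<noteq> {}"
  shows "2 * card (neighbors (symplectic_graph \<nu>) x \<inter> C) = card C"
proof -
  let ?N = "neighbors (symplectic_graph \<nu>) x"
  define h where "h y = swap_blocks {Min (blocks_of_weight \<nu> 1 y)} y" for y
  have carrier: "y \<in> carrier_vec (2 * \<nu>)" if "y \<in> C" for y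
    using that C by (auto simp: pverts_symplectic_graph)
  have Min: "Min (blocks_of_weight \<nu> 1 y) \<in> blocks_of_weight \<nu> 1 y" if "y \<in> C" for y
    using ne[OF that] by simp
  have hC: "h y \<in> C" if "y \<in> C" for y
    using Min[OF that] closed[OF that] by (simp add: h_def blocks_of_weight_def)
  have hh: "h (h y) = y" if "y \<in> C" for y
    unfolding h_def blocks_of_weight_swap_blocks[OF carrier[OF that]]
    by (rule swap_blocks_swap_blocks[OF carrier[OF that]])
  have hN: "h y \<in> ?N \<longleftrightarrow> y \<notin> ?N" if "y \<in> C" for y
  proof -
    have "x \<bullet> (K_mat \<nu> *\<^sub>v h y) = x \<bullet> (K_mat \<nu> *\<^sub>v y) + 1"
      unfolding h_def using x(1) Min[OF that] carrier[OF that]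
      by (intro symplectic_form_swap_one_block)
         (auto simp: O_set_all_weight_one_iff blocks_of_weight_def)
    then have "x \<bullet> (K_mat \<nu> *\<^sub>v h y) = 1 \<longleftrightarrow> x \<bullet> (K_mat \<nu> *\<^sub>v y) \<noteq> 1"
      by (cases "x \<bullet> (K_mat \<nu> *\<^sub>v y)") simp_all
    then show ?thesis
      using that hC[OF that] C x(2) by (auto simp: neighbors_def parcs_symplectic_graph)
  qed
  have "bij_betw h (?N \<inter> C) (C - ?N)"
    by (rule bij_betw_byWitness[where f' = h]) (use hC hh hN in auto)
  then have "card (?N \<inter> C) = card (C - ?N)"
    by (rule bij_betw_same_card)
  moreover have "card C = card (?N \<inter> C) + card (C - ?N)"
    using finite_subset[OF C finite_pverts_symplectic_graph]
    by (metis Int_commute card_Int_Diff)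
  ultimately show ?thesis
    by simp
qed

text \<open>The hypotheses are the common features of the sets \<open>O(i, j, k)\<close> and of the orbits, so
  that one count serves the formula as well as the cell condition.\<close>

lemma card_neighbors_swap_closed_set:
  assumes x: "x \<in> O_set \<nu> 0 \<nu> 0" "x \<in> pverts (symplectic_graph \<nu>)"
    and C: "C \<subseteq> pverts (symplectic_graph \<nu>)"
    and closed: "\<And>y m. y \<in> C \<Longrightarrow> m < \<nu> \<Longrightarrow> swap_blocks {m} y \<in> C"
    and i: "\<And>y. y \<in> C \<Longrightarrow> card (blocks_of_weight \<nu> 2 y) = i"
    and j: "\<And>y. y \<in> C \<Longrightarrow> card (blocks_of_weight \<nu> 1 y) = j"
  shows "real (card (neighbors (symplectic_graph \<nu>) x \<inter> C)) =
    (if j \<ge> 1 then 1/2 * real (card C) else if odd i then real (card C) else 0)"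
proof (cases "j \<ge> 1")
  case True
  then have "2 * card (neighbors (symplectic_graph \<nu>) x \<inter> C) = card C"
    using j by (intro half_of_swap_closed_set[OF x C closed]) fastforce+
  then show ?thesis
    using True by (simp flip: of_nat_mult)
next
  case False
  have "y \<in> neighbors (symplectic_graph \<nu>) x \<longleftrightarrow> odd i" if y: "y \<in> C" for y
  proof -
    have "card (blocks_of_weight \<nu> 1 y) = 0"
      using j[OF y] False by linarith
    then have "blocks_of_weight \<nu> 1 y = {}"
      by simp
    then have "x \<bullet> (K_mat \<nu> *\<^sub>v y) = of_nat i"
      using x(1) C y i[OF y] symplectic_form_no_weight_one[of x \<nu> y]
      by (auto simp: O_set_all_weight_one_iff pverts_symplectic_graph)
    then show ?thesis
      using x(2) C y by (auto simp: neighbors_def parcs_symplectic_graph of_nat_bit_eq_1_iff)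
  qed
  then have "neighbors (symplectic_graph \<nu>) x \<inter> C = (if odd i then C else {})"
    by auto
  then show ?thesis
    using False by simp
qed

section \<open>Block weights along orbits\<close>

lemma unit_vec_bit_eq_iff:
  assumes "l < n" "l' < n"
  shows "(unit_vec n l :: bit vec) = unit_vec n l' \<longleftrightarrow> l = l'"
  using assms by (metis index_unit_vec(1) one_neq_zero)

text \<open>This characterizes the division of the basis into blocks by the graph, so that automorphisms
  must respect it.\<close>

lemma basis_pair_iff_edge:
  "M \<in> basis_pair \<nu> ` {..<\<nu>} \<longleftrightarrow>
     (\<exists>a\<in>std_basis \<nu>. \<exists>b\<in>std_basis \<nu>. (a, b) \<in> parcs (symplectic_graph \<nu>) \<and> M = {a, b})"
proof -
  let ?e = "unit_vec (2 * \<nu>) :: nat \<Rightarrow> bit vec"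
  have edge: "(?e l, ?e l') \<in> parcs (symplectic_graph \<nu>) \<longleftrightarrow> l' = partner l"
    if "l < 2 * \<nu>" "l' < 2 * \<nu>" for l l'
    using unit_vec_in_neighbors_iff[OF unit_vec_in_pverts[OF that(1)] that(2)] that
    by (auto simp: neighbors_def partner_less split: if_splits)
  have pair: "{?e l, ?e (partner l)} = basis_pair \<nu> (l div 2)" for l
    by (auto simp: basis_pair_def partner_def elim!: evenE oddE)
  have "(\<exists>a\<in>std_basis \<nu>. \<exists>b\<in>std_basis \<nu>. (a, b) \<in> parcs (symplectic_graph \<nu>) \<and> M = {a, b}) \<longleftrightarrow>
      (\<exists>l<2 * \<nu>. \<exists>l'<2 * \<nu>. (?e l, ?e l') \<in> parcs (symplectic_graph \<nu>) \<and> M = {?e l, ?e l'})"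
    by (auto simp: std_basis_def)
  also have "\<dots> \<longleftrightarrow> (\<exists>l<2 * \<nu>. M = {?e l, ?e (partner l)})"
    using edge partner_less by metis
  also have "\<dots> \<longleftrightarrow> (\<exists>l<2 * \<nu>. M = basis_pair \<nu> (l div 2))"
    by (simp only: pair)
  also have "\<dots> \<longleftrightarrow> (\<exists>m<\<nu>. M = basis_pair \<nu> m)"
  proof
    assume "\<exists>m<\<nu>. M = basis_pair \<nu> m"
    then obtain m where "m < \<nu>" "M = basis_pair \<nu> m" by blast
    then show "\<exists>l<2 * \<nu>. M = basis_pair \<nu> (l div 2)"
      by (intro exI[of _ "2 * m"]) simp
  qed (auto intro: less_mult_imp_div_less simp: mult.commute)
  finally show ?thesis
    by auto
qed

lemma inj_on_basis_pair: "inj_on (basis_pair \<nu>) {..<\<nu>}"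
proof (rule inj_onI)
  fix m n assume mn: "m \<in> {..<\<nu>}" "n \<in> {..<\<nu>}" "basis_pair \<nu> m = basis_pair \<nu> n"
  have "unit_vec (2 * \<nu>) (2 * m) \<in> basis_pair \<nu> m"
    by (simp add: basis_pair_def)
  then have "unit_vec (2 * \<nu>) (2 * m) \<in> basis_pair \<nu> n"
    by (simp only: mn(3))
  then have "2 * m = 2 * n \<or> 2 * m = 2 * n + 1"
    using mn(1,2) by (auto simp: basis_pair_def unit_vec_bit_eq_iff)
  then show "m = n"
    by presburger
qed

lemma card_neighbors_basis_pair:
  assumes "y \<in> pverts (symplectic_graph \<nu>)" "m < \<nu>"
  shows "card (neighbors (symplectic_graph \<nu>) y \<inter> basis_pair \<nu> m) = wt (block y m)"
proof -
  let ?e = "unit_vec (2 * \<nu>) :: nat \<Rightarrow> bit vec"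
  have "neighbors (symplectic_graph \<nu>) y \<inter> basis_pair \<nu> m =
      (if y $ (2 * m + 1) = 1 then {?e (2 * m)} else {}) \<union>
      (if y $ (2 * m) = 1 then {?e (2 * m + 1)} else {})"
    using assms unit_vec_in_neighbors_iff[OF assms(1), of "2 * m"]
      unit_vec_in_neighbors_iff[OF assms(1), of "2 * m + 1"]
    by (auto simp: basis_pair_def)
  moreover have "?e (2 * m) \<noteq> ?e (2 * m + 1)"
    using assms(2) by (simp add: unit_vec_bit_eq_iff)
  ultimately show ?thesis
    by (auto simp: wt_block)
qed

lemma card_blocks_of_weight:
  assumes "y \<in> pverts (symplectic_graph \<nu>)"
  shows "card (blocks_of_weight \<nu> w y) =
    card {M \<in> basis_pair \<nu> ` {..<\<nu>}. card (neighbors (symplectic_graph \<nu>) y \<inter> M) = w}"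
proof -
  have "basis_pair \<nu> ` blocks_of_weight \<nu> w y =
      {M \<in> basis_pair \<nu> ` {..<\<nu>}. card (neighbors (symplectic_graph \<nu>) y \<inter> M) = w}"
    using card_neighbors_basis_pair[OF assms] by (auto simp: blocks_of_weight_def)
  moreover have "inj_on (basis_pair \<nu>) (blocks_of_weight \<nu> w y)"
    by (rule inj_on_subset[OF inj_on_basis_pair]) (auto simp: blocks_of_weight_def)
  ultimately show ?thesis
    by (metis card_image)
qed

text \<open>An automorphism \<open>g\<close> permutes the basis pairs, and \<open>g y\<close> has as many neighbours in \<open>g ` M\<close>
  as \<open>y\<close> has in \<open>M\<close>. The opposite inequality is the same statement for the inverse of \<open>g\<close>.\<close>

lemma card_blocks_of_weight_Aut_le:
  assumes g: "g \<in> carrier (Aut_setwise (symplectic_graph \<nu>) (std_basis \<nu>))"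
    and y: "y \<in> pverts (symplectic_graph \<nu>)"
  shows "card (blocks_of_weight \<nu> w y) \<le> card (blocks_of_weight \<nu> w (g y))"
proof -
  let ?X = "symplectic_graph \<nu>"
  let ?P = "\<lambda>z. {M \<in> basis_pair \<nu> ` {..<\<nu>}. card (neighbors ?X z \<inter> M) = w}"
  have bij: "inj_on g (pverts ?X)" "g ` pverts ?X = pverts ?X"
    using g by (auto simp: carrier_Aut_setwise Bij_def bij_betw_def)
  have sub: "M \<subseteq> pverts ?X" if "M \<in> basis_pair \<nu> ` {..<\<nu>}" for M
    using that std_basis_subset_pverts by (auto simp: basis_pair_iff_edge)
  have edge: "g ` M \<in> basis_pair \<nu> ` {..<\<nu>}" if M: "M \<in> basis_pair \<nu> ` {..<\<nu>}" for M
  proof -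
    obtain a b where ab: "a \<in> std_basis \<nu>" "b \<in> std_basis \<nu>" "(a, b) \<in> parcs ?X" "M = {a, b}"
      using M unfolding basis_pair_iff_edge by blast
    then have "g a \<in> std_basis \<nu>" "g b \<in> std_basis \<nu>" "(g a, g b) \<in> parcs ?X"
      using g subsetD[OF std_basis_subset_pverts] by (auto simp: carrier_Aut_setwise)
    then show ?thesis
      using ab(4) by (auto simp: basis_pair_iff_edge)
  qed
  have "card (neighbors ?X (g y) \<inter> g ` M) = card (neighbors ?X y \<inter> M)"
    if "M \<in> basis_pair \<nu> ` {..<\<nu>}" for M
  proof -
    have "inj_on g (neighbors ?X y \<inter> M)"
      using bij(1) sub[OF that] by (blast intro: inj_on_subset)
    then show ?thesis
      using image_neighbors[OF g y sub[OF that]] by (metis card_image)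
  qed
  then have "image g ` ?P y \<subseteq> ?P (g y)"
    using edge by auto
  moreover have "inj_on (image g) (?P y)"
    using sub inj_on_subset[OF inj_on_image_Pow[OF bij(1)]] by (metis (no_types, lifting) PowI mem_Collect_eq subsetI)
  ultimately have "card (?P y) \<le> card (?P (g y))"
    by (intro card_inj_on_le[of "image g"]) auto
  moreover have "g y \<in> pverts ?X"
    using y bij(2) by blast
  ultimately show ?thesis
    using y by (simp only: card_blocks_of_weight)
qed

lemma card_blocks_of_weight_orbit:
  assumes z: "z \<in> pverts (symplectic_graph \<nu>)"
    and y: "y \<in> orbit (Aut_setwise (symplectic_graph \<nu>) (std_basis \<nu>)) (\<lambda>g. g) z"
  shows "card (blocks_of_weight \<nu> w y) = card (blocks_of_weight \<nu> w z)"
proof -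
  interpret group_action "Aut_setwise (symplectic_graph \<nu>) (std_basis \<nu>)"
      "pverts (symplectic_graph \<nu>)" "\<lambda>g. g"
    by (rule Aut_setwise_action[OF std_basis_subset_pverts])
  have yV: "y \<in> pverts (symplectic_graph \<nu>)"
    using y z element_image by (auto simp: orbit_def)
  show ?thesis
    using y z orbit_sym[OF z yV y] yV card_blocks_of_weight_Aut_le
    by (intro order_antisym) (fastforce simp: orbit_def)+
qed

text \<open>Two vectors whose blocks all have weight 1 differ by a swap in the blocks where their first
  coordinates differ. The converse inclusion is the invariance of the block weights.\<close>

lemma all_weight_one_eq_orbit:
  assumes x: "x \<in> O_set \<nu> 0 \<nu> 0" "x \<in> pverts (symplectic_graph \<nu>)"
  shows "O_set \<nu> 0 \<nu> 0 = orbit (Aut_setwise (symplectic_graph \<nu>) (std_basis \<nu>)) (\<lambda>g. g) x"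
    (is "_ = ?orb")
proof
  show "?orb \<subseteq> O_set \<nu> 0 \<nu> 0"
  proof
    fix y assume y: "y \<in> ?orb"
    interpret group_action "Aut_setwise (symplectic_graph \<nu>) (std_basis \<nu>)"
        "pverts (symplectic_graph \<nu>)" "\<lambda>g. g"
      by (rule Aut_setwise_action[OF std_basis_subset_pverts])
    have "y \<in> pverts (symplectic_graph \<nu>)"
      using y x(2) element_image by (auto simp: orbit_def)
    then show "y \<in> O_set \<nu> 0 \<nu> 0"
      using x(1) card_blocks_of_weight_orbit[OF x(2) y]
      by (simp add: O_set_iff pverts_symplectic_graph)
  qed
  show "O_set \<nu> 0 \<nu> 0 \<subseteq> ?orb"
  proof
    fix y assume y: "y \<in> O_set \<nu> 0 \<nu> 0"
    let ?g = "restrict (swap_blocks {m. x $ (2 * m) \<noteq> y $ (2 * m)}) (pverts (symplectic_graph \<nu>))"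
    have carrier: "x \<in> carrier_vec (2 * \<nu>)" "y \<in> carrier_vec (2 * \<nu>)"
      using x(1) y by (auto simp: O_set_iff)
    have "y = swap_blocks {m. x $ (2 * m) \<noteq> y $ (2 * m)} x"
    proof (rule eq_vecI)
      fix l assume "l < dim_vec (swap_blocks {m. x $ (2 * m) \<noteq> y $ (2 * m)} x)"
      then have l: "l < 2 * \<nu>"
        using carrier by (simp add: swap_blocks_def)
      define m where "m = l div 2"
      have m: "m < \<nu>"
        using l by (simp add: m_def less_mult_imp_div_less mult.commute)
      have "l = 2 * m \<or> l = 2 * m + 1"
        by (auto simp: m_def)
      moreover have "x $ (2 * m + 1) = x $ (2 * m) + 1" "y $ (2 * m + 1) = y $ (2 * m) + 1"
        using x(1) y m by (simp_all only: O_set_all_weight_one_iff flip: wt_block_eq_1_iff)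
      moreover have "swap_blocks {m. x $ (2 * m) \<noteq> y $ (2 * m)} x $ l =
          (if x $ (2 * m) \<noteq> y $ (2 * m) then x $ partner l else x $ l)"
        using carrier(1) l by (simp add: swap_blocks_index m_def)
      ultimately show "y $ l = swap_blocks {m. x $ (2 * m) \<noteq> y $ (2 * m)} x $ l"
        by (cases "x $ (2 * m)"; cases "y $ (2 * m)") auto
    qed (use carrier in \<open>simp add: swap_blocks_def\<close>)
    then have "y = ?g x"
      using x(2) by simp
    then show "y \<in> ?orb"
      unfolding orbit_def using swap_blocks_in_Aut_setwise by blast
  qed
qed

lemma orbit_swap_closed:
  assumes z: "z \<in> pverts (symplectic_graph \<nu>)"
    and y: "y \<in> orbit (Aut_setwise (symplectic_graph \<nu>) (std_basis \<nu>)) (\<lambda>g. g) z"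
  shows "swap_blocks S y \<in> orbit (Aut_setwise (symplectic_graph \<nu>) (std_basis \<nu>)) (\<lambda>g. g) z"
proof -
  interpret group_action "Aut_setwise (symplectic_graph \<nu>) (std_basis \<nu>)"
      "pverts (symplectic_graph \<nu>)" "\<lambda>g. g"
    by (rule Aut_setwise_action[OF std_basis_subset_pverts])
  have yV: "y \<in> pverts (symplectic_graph \<nu>)"
    using y z element_image by (auto simp: orbit_def)
  then have "swap_blocks S y = restrict (swap_blocks S) (pverts (symplectic_graph \<nu>)) y"
    by simp
  then have "swap_blocks S y \<in> orbit (Aut_setwise (symplectic_graph \<nu>) (std_basis \<nu>)) (\<lambda>g. g) y"
    unfolding orbit_def using swap_blocks_in_Aut_setwise by blast
  then show ?thesis
    using orbit_trans[OF z yV swap_blocks_in_pverts[OF yV] y] by blast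
qed

theorem proposition3p5:
  fixes \<nu> :: nat and X :: "bit vec pair_pre_digraph"
  assumes "3 \<le> \<nu>"
    and "X = symplectic_graph \<nu>"
  shows "(\<forall>x \<in> O_set \<nu> 0 \<nu> 0. \<forall>i j k. i + j + k = \<nu> \<and> (i, j, k) \<noteq> (0, 0, \<nu>) \<longrightarrow>
            real (card (neighbors X x \<inter> O_set \<nu> i j k)) =
              (if j \<ge> 1 then 1/2 * real (card (O_set \<nu> i j k))
               else if odd i then real (card (O_set \<nu> i j k))
               else 0))
       \<and> godsil_mckay_cell X (orbit_partition X (Aut_setwise X (std_basis \<nu>))) (O_set \<nu> 0 \<nu> 0)"
proof
  let ?D = "O_set \<nu> 0 \<nu> 0"
  let ?G = "Aut_setwise X (std_basis \<nu>)"
  let ?P = "orbit_partition X ?G"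
  have DV: "?D \<subseteq> pverts X"
    using O_set_subset_pverts[of 0 \<nu> 0 \<nu>] assms by auto
  show "\<forall>x \<in> ?D. \<forall>i j k. i + j + k = \<nu> \<and> (i, j, k) \<noteq> (0, 0, \<nu>) \<longrightarrow>
      real (card (neighbors X x \<inter> O_set \<nu> i j k)) =
        (if j \<ge> 1 then 1/2 * real (card (O_set \<nu> i j k))
         else if odd i then real (card (O_set \<nu> i j k)) else 0)"
  proof (intro ballI allI impI)
    fix x i j k assume x: "x \<in> ?D" and ijk: "i + j + k = \<nu> \<and> (i, j, k) \<noteq> (0, 0, \<nu>)"
    show "real (card (neighbors X x \<inter> O_set \<nu> i j k)) =
        (if j \<ge> 1 then 1/2 * real (card (O_set \<nu> i j k))
         else if odd i then real (card (O_set \<nu> i j k)) else 0)"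
      unfolding assms(2)
      using x DV ijk O_set_subset_pverts[of i j k \<nu>] swap_blocks_in_O_set
      by (intro card_neighbors_swap_closed_set) (auto simp: assms(2) O_set_iff)
  qed
  have S: "std_basis \<nu> \<subseteq> pverts X" and fin: "finite (pverts X)"
    using assms(2) by (simp_all add: std_basis_subset_pverts finite_pverts_symplectic_graph)
  \<comment> \<open>A witness that \<open>O(0, \<nu>, 0)\<close> is nonempty, hence the orbit of some vertex.\<close>
  define x\<^sub>0 :: "bit vec" where "x\<^sub>0 = vec (2 * \<nu>) (\<lambda>l. if even l then 1 else 0)"
  have x\<^sub>0: "x\<^sub>0 \<in> ?D"
    by (auto simp: O_set_all_weight_one_iff x\<^sub>0_def wt_block)
  have orbit: "\<exists>z \<in> pverts X. C = orbit ?G (\<lambda>g. g) z" if "C \<in> ?P" for C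
    using that by (auto simp: orbit_partition_def orbits_def)
  have part: "partition_on (pverts X) ?P"
    by (rule partition_orbit_partition[OF S])
  show "godsil_mckay_cell X ?P ?D"
    unfolding godsil_mckay_cell_def
  proof (intro conjI ballI)
    show "finite ?P"
      using finite_elements[OF fin part] .
    show "partition_on (pverts X) ?P"
      by (rule part)
    show "?D \<in> ?P"
      using all_weight_one_eq_orbit[OF x\<^sub>0] x\<^sub>0 DV assms(2)
      by (auto simp: orbit_partition_def orbits_def)
    show "card (neighbors X x \<inter> C') = card (neighbors X y \<inter> C')"
      if "C \<in> ?P - {?D}" "C' \<in> ?P - {?D}" "x \<in> C" "y \<in> C" for C C' x y
      using that orbit_partition_equitable[OF S fin, of C C' x y] by auto
    show "real (card (neighbors X x \<inter> C)) \<in> {0, 1/2 * real (card C), real (card C)}"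
      if x: "x \<in> ?D" and C: "C \<in> ?P - {?D}" for x C
    proof -
      obtain z where z: "z \<in> pverts X" "C = orbit ?G (\<lambda>g. g) z"
        using orbit C by blast
      have CV: "C \<subseteq> pverts X"
        using C partition_onD1[OF part] by blast
      show ?thesis
        using card_neighbors_swap_closed_set[of x \<nu> C "card (blocks_of_weight \<nu> 2 z)"
            "card (blocks_of_weight \<nu> 1 z)"]
          x DV CV orbit_swap_closed[of z \<nu>] card_blocks_of_weight_orbit[of z \<nu>] z
        by (auto simp: assms(2) split: if_splits)
    qed
  qed
qed

end
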